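(* Let $(X,\mathrm{d})$ be a compact metric space. For every countable dense subset $Y\subset X$, there exists a finite approximative sequence (FAS) $\{U_{2\varepsilon_n}(A_n),p_{n,n+1}\}_{n\in\mathbb{N}}$ of $X$ such that its inverse limit $\mathcal{X}$ has a dense subset which is homeomorphic to $Y$ (with the subspace topologies).
   Context: Let $(X,\mathrm{d})$ be a compact metric space. Hyperspaces: $2^X$ is the set of non-empty closed subsets of $X$. The upper semifinite topology on $2^X$ has as base the sets $B(U)=\{C\in 2^X: C\subset U\}$, $U\subset X$ open; the resulting space is $2^X_u$. If $A\subset X$ is finite and non-empty, $2^A_u$ is the (finite) set of non-empty subsets of $A$ with the upper semifinite topology, i.e. the topology with base the sets $2^C=\{D: \emptyset\neq D\subset C\}$, $\emptyset\ne C\subset A$. For $\varepsilon>0$, $U_{2\varepsilon}(A)=\{C\in 2^A:\operatorname{diam}(C)<2\varepsilon\}\subset 2^A_u$ with the subspace topology. Approximations: A finite subset $A\subset X$ is a finite $\varepsilon$-approximation of $X$ if for every $x\in X$ there is $a\in A$ with $\mathrm{d}(x,a)<\varepsilon$. For $x\in X$ put $A(x)=\{a\in A:\mathrm{d}(x,a)=\mathrm{d}(x,A)\}$ and, for $C\in 2^X$, $r_A(C)=\bigcup_{c\in C}A(c)$. If $A$ is a finite $\varepsilon$-approximation, let $\gamma=\sup\{\mathrm{d}(x,A):x\in X\}$ (so $\gamma<\varepsilon$). A number $0<\varepsilon'<\varepsilon$ is adjusted to $A$ if $\varepsilon'<\frac{\varepsilon-\gamma}{2}$. In that case, for every finite $\varepsilon'$-approximation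 $A'$, the map $p:U_{2\varepsilon'}(A')\to U_{2\varepsilon}(A)$, $p(C)=r_A(C)$, is well defined and continuous. FAS: A finite approximative sequence of $X$ is an inverse sequence $\{U_{2\varepsilon_n}(A_n),p_{n,n+1}\}_{n\in\mathbb{N}}$ (with $n\geq 1$), where $\{\varepsilon_n\}$ is a sequence of positive reals converging to zero, each $A_n$ is a finite $\varepsilon_n$-approximation of $X$, $\varepsilon_{n+1}$ is adjusted to $A_n$ for every $n$, and $p_{n,n+1}:U_{2\varepsilon_{n+1}}(A_{n+1})\to U_{2\varepsilon_n}(A_n)$ is $p_{n,n+1}(C)=r_{A_n}(C)$. Its inverse limit $\mathcal{X}$ is the subspace of $\prod_n U_{2\varepsilon_n}(A_n)$ of sequences $\{C_n\}$ with $p_{n,n+1}(C_{n+1})=C_n$ for all $n$. *)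

theory Defs
  imports "HOL-Analysis.Analysis"
begin

definition finite_approximation :: "'a::metric_space set \<Rightarrow> real \<Rightarrow> 'a set \<Rightarrow> bool" where
  "finite_approximation X \<epsilon> A \<longleftrightarrow> finite A \<and> A \<subseteq> X \<and> (\<forall>x\<in>X. \<exists>a\<in>A. dist x a < \<epsilon>)"

definition nearest_points :: "'a::metric_space set \<Rightarrow> 'a \<Rightarrow> 'a set" where
  "nearest_points A x = {a \<in> A. dist x a = infdist x A}"

definition nearest_map :: "'a::metric_space set \<Rightarrow> 'a set \<Rightarrow> 'a set" where
  "nearest_map A C = (\<Union>c\<in>C. nearest_points A c)"

(* The supremum is taken among nonnegative reals, hence 0 for empty X; Sup {} is unspecified on
   the reals. *)
definition approximation_radius :: "'a::metric_space set \<Rightarrow> 'a set \<Rightarrow> real" where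
  "approximation_radius X A = (if X = {} then 0 else SUP x\<in>X. infdist x A)"

definition adjusted :: "'a::metric_space set \<Rightarrow> 'a set \<Rightarrow> real \<Rightarrow> real \<Rightarrow> bool" where
  "adjusted X A \<epsilon> \<epsilon>' \<longleftrightarrow> 0 < \<epsilon>' \<and> \<epsilon>' < \<epsilon> \<and> \<epsilon>' < (\<epsilon> - approximation_radius X A) / 2"

definition nonempty_subsets :: "'a set \<Rightarrow> 'a set set" where
  "nonempty_subsets A = {D. D \<noteq> {} \<and> D \<subseteq> A}"

(* Intended for finite A. The generating family is a base, not just a subbase: two of its members
   intersect in a member or in the empty set. *)
definition upper_semifinite :: "'a set \<Rightarrow> 'a set topology" where
  "upper_semifinite A = topology_generated_by (nonempty_subsets ` nonempty_subsets A)"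

lemma topspace_upper_semifinite [simp]: "topspace (upper_semifinite A) = nonempty_subsets A"
proof -
  have "\<Union>(nonempty_subsets ` nonempty_subsets A) = nonempty_subsets A"
    unfolding nonempty_subsets_def by blast
  then show ?thesis
    by (simp add: upper_semifinite_def)
qed

lemma openin_upper_semifinite_iff:
  "openin (upper_semifinite A) W \<longleftrightarrow>
    (\<exists>\<B>. \<B> \<subseteq> nonempty_subsets ` nonempty_subsets A \<and> W = \<Union>\<B>)"
proof
  assume "openin (upper_semifinite A) W"
  then have gen: "generate_topology_on (nonempty_subsets ` nonempty_subsets A) W"
    by (simp add: upper_semifinite_def openin_topology_generated_by_iff)
  have "W \<subseteq> nonempty_subsets A \<and> (\<forall>C\<in>W. nonempty_subsets C \<subseteq> W)"
    using gen
  proof (induction rule: generate_topology_on.induct)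
    case Empty
    show ?case by simp
  next
    case (Int V V')
    then show ?case by blast
  next
    case (UN K)
    then show ?case by blast
  next
    case (Basis V)
    then obtain C where "V = nonempty_subsets C" "C \<subseteq> A"
      by (auto simp: nonempty_subsets_def)
    then show ?case
      unfolding nonempty_subsets_def by blast
  qed
  moreover from this have "W = \<Union>(nonempty_subsets ` W)"
    unfolding nonempty_subsets_def by blast
  ultimately show "\<exists>\<B>. \<B> \<subseteq> nonempty_subsets ` nonempty_subsets A \<and> W = \<Union>\<B>"
    by (meson image_mono)
next
  assume "\<exists>\<B>. \<B> \<subseteq> nonempty_subsets ` nonempty_subsets A \<and> W = \<Union>\<B>"
  then obtain \<B> where \<B>: "\<B> \<subseteq> nonempty_subsets ` nonempty_subsets A" and W: "W = \<Union>\<B>"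
    by blast
  have "openin (upper_semifinite A) V" if "V \<in> \<B>" for V
    unfolding upper_semifinite_def
    by (rule topology_generated_by_Basis) (use \<B> that in blast)
  then show "openin (upper_semifinite A) W"
    unfolding W by (rule openin_Union)
qed

(* With r = 2 * \<epsilon> this is the space written U with subscript 2 * \<epsilon>. *)
definition small_subsets :: "real \<Rightarrow> 'a::metric_space set \<Rightarrow> 'a set topology" where
  "small_subsets r A =
    subtopology (upper_semifinite A) {C \<in> nonempty_subsets A. diameter C < r}"

definition inverse_limit :: "(nat \<Rightarrow> 'b topology) \<Rightarrow> (nat \<Rightarrow> 'b \<Rightarrow> 'b) \<Rightarrow> (nat \<Rightarrow> 'b) topology" where
  "inverse_limit T p = subtopology (product_topology T UNIV) {x. \<forall>n. p n (x (Suc n)) = x n}"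

(* The spaces and bonding maps of the sequence are determined by \<epsilon> and A. *)
definition finite_approximative_sequence ::
  "'a::metric_space set \<Rightarrow> (nat \<Rightarrow> real) \<Rightarrow> (nat \<Rightarrow> 'a set) \<Rightarrow> bool" where
  "finite_approximative_sequence X \<epsilon> A \<longleftrightarrow>
    (\<forall>n. 0 < \<epsilon> n) \<and> \<epsilon> \<longlonglongrightarrow> 0 \<and>
    (\<forall>n. finite_approximation X (\<epsilon> n) (A n)) \<and>
    (\<forall>n. adjusted X (A n) (\<epsilon> n) (\<epsilon> (Suc n)))"

definition fas_limit :: "(nat \<Rightarrow> real) \<Rightarrow> (nat \<Rightarrow> 'a::metric_space set) \<Rightarrow> (nat \<Rightarrow> 'a set) topology" where
  "fas_limit \<epsilon> A =
    inverse_limit (\<lambda>n. small_subsets (2 * \<epsilon> n) (A n)) (\<lambda>n. nearest_map (A n))"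

end

theory Submission
  imports Defs
begin

text \<open>
  The approximations \<open>A n\<close> are chosen increasing, inside \<open>Y\<close> and with union \<open>Y\<close>. A point
  \<open>y \<in> Y\<close> then belongs to all \<open>A n\<close> from some level on, and is its own unique nearest point there.
  So the singletons \<open>{y}\<close> at high levels are compatible with the bonding maps, and pushing them
  down gives a point of the inverse limit, the thread of \<open>y\<close>. The dense subset is the set of all
  threads.

  Density needs only the shape of the topology. The bonding maps preserve inclusion, so a
  neighbourhood of a point \<open>C\<close> of the limit always contains all points \<open>D\<close> of the limit with
  \<open>D n \<subseteq> C n\<close>, for some single level \<open>n\<close> (lemma \<open>openin_fas_limit_contains_below\<close>). Any
  \<open>c \<in> C n\<close> lies in \<open>A n\<close>, and its thread passes through \<open>{c}\<close> at level \<open>n\<close>.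

  That \<open>y\<close> and its thread determine each other continuously rests on two estimates. By
  adjustedness the distances passed through on the way down do not accumulate: level \<open>n\<close> of the
  thread of \<open>z\<close> stays within \<open>\<epsilon> n\<close> of \<open>z\<close> (\<open>dist_thread_less\<close>), so threads that agree at a high
  level come from close points. Conversely, each \<open>\<epsilon> (Suc n)\<close> is chosen small compared with the
  mutual distances of the points of \<open>A n\<close>; then, for \<open>y \<in> A n\<close>, any \<open>z\<close> close to \<open>y\<close> has level
  \<open>n + 1\<close> of its thread so close to \<open>y\<close> that level \<open>n\<close> is exactly \<open>{y}\<close> (\<open>thread_eq_singleton\<close>).
\<close>

section \<open>Nearest points\<close>

lemma nearest_points_self: "a \<in> A \<Longrightarrow> nearest_points A a = {a}"
  by (auto simp: nearest_points_def)

lemma nearest_points_nonempty: "finite A \<Longrightarrow> A \<noteq> {} \<Longrightarrow> nearest_points A x \<noteq> {}"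
proof -
  assume A: "finite A" "A \<noteq> {}"
  then have "infdist x A = Min (dist x ` A)"
    by (simp add: infdist_notempty cInf_eq_Min)
  moreover have "Min (dist x ` A) \<in> dist x ` A"
    using A by (intro Min_in) auto
  ultimately show ?thesis
    by (force simp: nearest_points_def)
qed

lemma nearest_map_mono: "C \<subseteq> D \<Longrightarrow> nearest_map A C \<subseteq> nearest_map A D"
  by (auto simp: nearest_map_def)

lemma nearest_map_subset: "nearest_map A C \<subseteq> A"
  by (auto simp: nearest_map_def nearest_points_def)

lemma infdist_less_finite_approximation:
  assumes "finite_approximation X e A" "x \<in> X"
  shows "infdist x A < e"
  using assms infdist_le le_less_trans unfolding finite_approximation_def by metis

lemma infdist_le_approximation_radius:
  assumes "finite_approximation X e A" "x \<in> X"
  shows "infdist x A \<le> approximation_radius X A"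
proof -
  have "bdd_above ((\<lambda>x. infdist x A) ` X)"
    using infdist_less_finite_approximation[OF assms(1)] by (intro bdd_aboveI2[of _ _ e]) force
  then show ?thesis
    using assms(2) by (auto simp: approximation_radius_def intro: cSUP_upper)
qed

text \<open>The strict inequality survives taking the supremum because compactness makes it a maximum.\<close>

lemma approximation_radius_less:
  assumes "compact X" "0 < e" "finite_approximation X e A"
  shows "approximation_radius X A < e"
proof (cases "X = {}")
  case True
  then show ?thesis using assms(2) by (simp add: approximation_radius_def)
next
  case False
  have "continuous_on X (\<lambda>x. infdist x A)"
    by (intro continuous_intros)
  then obtain m where m: "m \<in> X" "\<And>x. x \<in> X \<Longrightarrow> infdist x A \<le> infdist m A"
    using continuous_attains_sup[OF assms(1) False] by blast
  have "approximation_radius X A \<le> infdist m A"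
    using False m(2) by (auto simp: approximation_radius_def intro: cSUP_least)
  then show ?thesis
    using infdist_less_finite_approximation[OF assms(3) m(1)] by linarith
qed

section \<open>The topology of the inverse limit\<close>

lemma topspace_small_subsets:
  "topspace (small_subsets r A) = {C. C \<noteq> {} \<and> C \<subseteq> A \<and> diameter C < r}"
  by (auto simp: small_subsets_def nonempty_subsets_def)

lemma openin_small_subsets_downward_closed:
  assumes "openin (small_subsets r A) W" "C \<in> W" "D \<subseteq> C" "D \<in> topspace (small_subsets r A)"
  shows "D \<in> W"
proof -
  obtain V where V: "openin (upper_semifinite A) V"
    and W: "W = V \<inter> {C \<in> nonempty_subsets A. diameter C < r}"
    using assms(1) unfolding small_subsets_def openin_subtopology by blast
  have D: "D \<noteq> {}" "D \<subseteq> A" "diameter D < r"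
    using assms(4) unfolding topspace_small_subsets by auto
  obtain \<B> where \<B>: "\<B> \<subseteq> nonempty_subsets ` nonempty_subsets A" "V = \<Union>\<B>"
    using V unfolding openin_upper_semifinite_iff by (elim exE conjE)
  have "C \<in> V" using assms(2) unfolding W by (rule IntD1)
  then obtain B where B: "B \<in> \<B>" "C \<in> B" unfolding \<B>(2) by (rule UnionE)
  then obtain E where E: "B = nonempty_subsets E" using \<B>(1) by (meson imageE subsetD)
  have "D \<in> B"
    using B(2) assms(3) D(1) unfolding E nonempty_subsets_def by blast
  then have "D \<in> V"
    using \<B>(2) B(1) by (simp only: UnionI)
  with D show ?thesis
    unfolding W by (simp add: nonempty_subsets_def)
qed

lemma openin_small_subsets_below:
  assumes "C \<in> topspace (small_subsets r A)"
  shows "openin (small_subsets r A) {D \<in> topspace (small_subsets r A). D \<subseteq> C}"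
proof -
  have C: "C \<in> nonempty_subsets A"
    using assms by (simp add: topspace_small_subsets nonempty_subsets_def)
  then have "openin (upper_semifinite A) (nonempty_subsets C)"
    unfolding openin_upper_semifinite_iff by (intro exI[of _ "{nonempty_subsets C}"]) simp
  moreover have "{D \<in> topspace (small_subsets r A). D \<subseteq> C}
    = nonempty_subsets C \<inter> {C \<in> nonempty_subsets A. diameter C < r}"
    using C by (auto simp: topspace_small_subsets nonempty_subsets_def)
  ultimately show ?thesis
    unfolding small_subsets_def openin_subtopology by metis
qed

lemma topspace_fas_limit:
  "C \<in> topspace (fas_limit \<epsilon> A) \<longleftrightarrow>
    (\<forall>n. C n \<in> topspace (small_subsets (2 * \<epsilon> n) (A n))) \<and>
    (\<forall>n. nearest_map (A n) (C (Suc n)) = C n)"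
  by (auto simp: fas_limit_def inverse_limit_def PiE_iff)

lemma fas_limit_subset_below:
  assumes "C \<in> topspace (fas_limit \<epsilon> A)" "D \<in> topspace (fas_limit \<epsilon> A)"
    and "D n \<subseteq> C n" "m \<le> n"
  shows "D m \<subseteq> C m"
  using \<open>m \<le> n\<close> \<open>D n \<subseteq> C n\<close>
proof (induction rule: dec_induct)
  case base
  then show ?case .
next
  case (step k)
  have "nearest_map (A k) (D (Suc k)) \<subseteq> nearest_map (A k) (C (Suc k))"
    using step.prems by (rule nearest_map_mono)
  with step.IH show ?case
    using assms(1,2) by (simp add: topspace_fas_limit)
qed

lemma openin_fas_limit_below:
  assumes "C \<in> topspace (fas_limit \<epsilon> A)"
  shows "openin (fas_limit \<epsilon> A) {D \<in> topspace (fas_limit \<epsilon> A). D n \<subseteq> C n}"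
proof -
  let ?T = "\<lambda>n. small_subsets (2 * \<epsilon> n) (A n)"
  have cont: "continuous_map (fas_limit \<epsilon> A) (?T n) (\<lambda>D. D n)"
    unfolding fas_limit_def inverse_limit_def
    by (intro continuous_map_from_subtopology continuous_map_product_projection) simp
  have "C n \<in> topspace (?T n)"
    using assms by (simp add: topspace_fas_limit)
  note openin_continuous_map_preimage[OF cont openin_small_subsets_below[OF this]]
  moreover have "D n \<in> topspace (?T n)" if "D \<in> topspace (fas_limit \<epsilon> A)" for D
    using that by (simp add: topspace_fas_limit)
  then have "{D \<in> topspace (fas_limit \<epsilon> A). D n \<in> {E \<in> topspace (?T n). E \<subseteq> C n}}
    = {D \<in> topspace (fas_limit \<epsilon> A). D n \<subseteq> C n}"
    by blast
  ultimately show ?thesis by (simp only:)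
qed

text \<open>
  A basic open set of the product restricts finitely many coordinates, and inclusion at the
  highest of them forces inclusion at all the others. The lower bound \<open>m\<close> lets the level be
  taken as high as desired.
\<close>

lemma openin_fas_limit_contains_below:
  assumes W: "openin (fas_limit \<epsilon> A) W" and "C \<in> W"
  obtains n where "m \<le> n" "\<And>D. D \<in> topspace (fas_limit \<epsilon> A) \<Longrightarrow> D n \<subseteq> C n \<Longrightarrow> D \<in> W"
proof -
  let ?T = "\<lambda>n. small_subsets (2 * \<epsilon> n) (A n)"
  let ?S = "{x. \<forall>n. nearest_map (A n) (x (Suc n)) = x n}"
  have C: "C \<in> topspace (fas_limit \<epsilon> A)"
    using openin_subset[OF W] \<open>C \<in> W\<close> by (rule subsetD)
  obtain V where V: "openin (product_topology ?T UNIV) V" and WV: "W = V \<inter> ?S"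
    using W unfolding fas_limit_def inverse_limit_def openin_subtopology by (elim exE conjE)
  have "C \<in> V"
    using \<open>C \<in> W\<close> unfolding WV by (rule IntD1)
  from openin_product_topology_alt[THEN iffD1, OF V, THEN bspec, OF this]
  obtain U where U0: "finite {i \<in> UNIV. U i \<noteq> topspace (?T i)}" "\<forall>i\<in>UNIV. openin (?T i) (U i)"
    and U: "C \<in> Pi\<^sub>E UNIV U" "Pi\<^sub>E UNIV U \<subseteq> V"
    by (elim exE conjE)
  obtain N where N: "\<And>i. U i \<noteq> topspace (?T i) \<Longrightarrow> i \<le> N"
    using U0(1) unfolding finite_nat_set_iff_bounded_le by auto
  show thesis
  proof
    show "m \<le> max m N" by simp
    fix D assume D: "D \<in> topspace (fas_limit \<epsilon> A)" and le: "D (max m N) \<subseteq> C (max m N)"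
    have DU: "D i \<in> U i" for i
    proof (cases "U i = topspace (?T i)")
      case True
      then show ?thesis using D by (simp add: topspace_fas_limit)
    next
      case False
      then have "i \<le> max m N" using N[of i] by simp
      then have "D i \<subseteq> C i"
        using fas_limit_subset_below[OF C D le] by blast
      moreover have "C i \<in> U i" using U(1) by (simp add: PiE_iff)
      moreover have "D i \<in> topspace (?T i)" using D by (simp add: topspace_fas_limit)
      ultimately show ?thesis
        using openin_small_subsets_downward_closed[of "2 * \<epsilon> i" "A i" "U i"] U0(2) by simp
    qed
    have "D \<in> Pi\<^sub>E UNIV U" by (rule PiE_I) (simp_all add: DU)
    moreover have "D \<in> ?S" using D by (simp add: topspace_fas_limit)
    ultimately show "D \<in> W" using U(2) WV by blast
  qed
qed

section \<open>Threads of the points of a dense set\<close>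

text \<open>
  The factor \<open>4\<close> in the separation condition leaves room for the two errors in
  \<open>thread_eq_singleton\<close>, each smaller than \<open>\<epsilon> (Suc n)\<close>: their sum must stay below half the
  distance of two points of \<open>A n\<close>.
\<close>

locale separated_fas =
  fixes X Y :: "'a::metric_space set" and \<epsilon> :: "nat \<Rightarrow> real" and A :: "nat \<Rightarrow> 'a set"
  assumes fas: "finite_approximative_sequence X \<epsilon> A"
    and Y_subset: "Y \<subseteq> X"
    and increasing: "A n \<subseteq> A (Suc n)"
    and exhausts: "(\<Union>n. A n) = Y"
    and separated: "a \<in> A n \<Longrightarrow> b \<in> A n \<Longrightarrow> a \<noteq> b \<Longrightarrow> 4 * \<epsilon> (Suc n) \<le> dist a b"
begin

lemma
  shows eps_pos: "0 < \<epsilon> n"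
    and eps_tendsto: "\<epsilon> \<longlonglongrightarrow> 0"
    and approximation: "finite_approximation X (\<epsilon> n) (A n)"
    and adjusted: "adjusted X (A n) (\<epsilon> n) (\<epsilon> (Suc n))"
  using fas by (auto simp: finite_approximative_sequence_def)

lemma A_mono: "m \<le> n \<Longrightarrow> A m \<subseteq> A n"
  using increasing by (rule lift_Suc_mono_le)

lemma A_subset_Y: "A n \<subseteq> Y"
  using exhausts by blast

text \<open>\<open>descend n k C\<close> is the image at level \<open>n\<close> of a set \<open>C\<close> at level \<open>n + k\<close>.\<close>

fun descend :: "nat \<Rightarrow> nat \<Rightarrow> 'a set \<Rightarrow> 'a set" where
  "descend n 0 C = C"
| "descend n (Suc k) C = nearest_map (A n) (descend (Suc n) k C)"

text \<open>
  Starting the descent to level \<open>n\<close> at level \<open>n + N\<close>, with \<open>N\<close> independent of \<open>n\<close>, avoids a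
  case distinction between the levels below and above \<open>N\<close>. By \<open>descend_singleton_stable\<close> the
  starting level does not matter as long as \<open>y\<close> has appeared there.
\<close>

definition thread :: "'a \<Rightarrow> nat \<Rightarrow> 'a set" where
  "thread y n = descend n (LEAST N. y \<in> A N) {y}"

lemma descend_singleton_stable:
  "y \<in> A (n + k) \<Longrightarrow> descend n (Suc k) {y} = descend n k {y}"
proof (induction k arbitrary: n)
  case 0
  then show ?case by (simp add: nearest_map_def nearest_points_self)
next
  case (Suc k)
  then have "descend (Suc n) (Suc k) {y} = descend (Suc n) k {y}" by simp
  then show ?case by (metis descend.simps(2))
qed

lemma descend_singleton: "y \<in> A n \<Longrightarrow> descend n k {y} = {y}"
proof (induction k arbitrary: n)
  case (Suc k)
  then have "descend (Suc n) k {y} = {y}" using increasing by blast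
  then show ?case using Suc.prems by (simp add: nearest_map_def nearest_points_self)
qed simp

lemma thread_eq_singleton_self: "y \<in> A n \<Longrightarrow> thread y n = {y}"
  by (simp add: thread_def descend_singleton)

lemma nearest_map_thread:
  assumes "y \<in> Y"
  shows "nearest_map (A n) (thread y (Suc n)) = thread y n"
proof -
  let ?N = "LEAST N. y \<in> A N"
  have "\<exists>N. y \<in> A N"
    using assms exhausts by blast
  then have "y \<in> A ?N" by (rule LeastI_ex)
  then have "y \<in> A (n + ?N)"
    using A_mono[of ?N "n + ?N"] by auto
  from descend_singleton_stable[OF this] show ?thesis
    by (simp add: thread_def)
qed

text \<open>
  The bound refines \<open>\<epsilon> n\<close> so that the induction down the levels closes: the step to level \<open>n\<close>
  moves a point by at most the approximation radius of \<open>A n\<close>, and adjustedness of the level above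
  leaves only \<open>\<epsilon> (Suc n)\<close> for everything that happened before.
\<close>

lemma thread_bounds:
  assumes "y \<in> Y"
  shows "thread y n \<noteq> {} \<and> thread y n \<subseteq> A n \<and>
    (\<forall>a\<in>thread y n. dist a y \<le> approximation_radius X (A n) + \<epsilon> (Suc n))"
proof -
  let ?r = "\<lambda>n. approximation_radius X (A n) + \<epsilon> (Suc n)"
  have yX: "y \<in> X" using assms Y_subset by blast
  obtain N where N: "y \<in> A N" using assms exhausts by blast
  have r_pos: "0 \<le> ?r n" for n
    using infdist_le_approximation_radius[OF approximation yX, of n] infdist_nonneg[of y "A n"]
      eps_pos[of "Suc n"] by linarith
  have high: "thread y n \<noteq> {} \<and> thread y n \<subseteq> A n \<and> (\<forall>a\<in>thread y n. dist a y \<le> ?r n)"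
    if "N \<le> n" for n
  proof -
    have "y \<in> A n" using N A_mono[OF that] by blast
    then show ?thesis using r_pos by (simp add: thread_eq_singleton_self)
  qed
  show ?thesis
  proof (cases "N \<le> n")
    case True
    then show ?thesis by (rule high)
  next
    case False
    then have "n \<le> N" by simp
    then show ?thesis
    proof (induction rule: inc_induct)
      case base
      show ?case using high by simp
    next
      case (step n)
      have fin: "finite (A n)" and ne: "A n \<noteq> {}"
        using approximation[of n] yX by (auto simp: finite_approximation_def)
      have eq: "thread y n = nearest_map (A n) (thread y (Suc n))"
        using nearest_map_thread[OF assms] by simp
      have "thread y n \<noteq> {}"
        using step.IH nearest_points_nonempty[OF fin ne] by (auto simp: eq nearest_map_def)
      moreover have "dist a y \<le> ?r n" if a: "a \<in> thread y n" for a
      proof -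
        obtain w where w: "w \<in> thread y (Suc n)" "a \<in> nearest_points (A n) w"
          using a by (auto simp: eq nearest_map_def)
        have "w \<in> X"
          using w(1) step.IH A_subset_Y Y_subset by blast
        then have "dist w a \<le> approximation_radius X (A n)"
          using w(2) infdist_le_approximation_radius[OF approximation]
          by (simp add: nearest_points_def)
        \<comment> \<open>Adjustedness makes the whole bound of the level above smaller than its \<open>\<epsilon>\<close>.\<close>
        moreover have "dist w y < \<epsilon> (Suc n)"
          using w(1) step.IH adjusted[of "Suc n"] eps_pos[of "Suc (Suc n)"]
          by (fastforce simp: adjusted_def)
        ultimately show ?thesis
          using dist_triangle2[of a y w] dist_triangle[of a y w] by (simp add: dist_commute)
      qed
      ultimately show ?case
        using nearest_map_subset by (auto simp: eq)
    qed
  qed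
qed

lemma radius_plus_eps_less: "approximation_radius X (A n) + \<epsilon> (Suc n) < \<epsilon> n"
  using adjusted[of n] eps_pos[of "Suc n"] by (simp add: adjusted_def)

lemma dist_thread_less: "y \<in> Y \<Longrightarrow> a \<in> thread y n \<Longrightarrow> dist a y < \<epsilon> n"
  using thread_bounds radius_plus_eps_less by (meson le_less_trans)

lemma thread_in_fas_limit:
  assumes "y \<in> Y"
  shows "thread y \<in> topspace (fas_limit \<epsilon> A)"
proof -
  have "diameter (thread y n) < 2 * \<epsilon> n" for n
  proof -
    let ?r = "approximation_radius X (A n) + \<epsilon> (Suc n)"
    have "dist a b \<le> ?r + ?r" if "a \<in> thread y n" "b \<in> thread y n" for a b
    proof -
      have "dist a y \<le> ?r" "dist b y \<le> ?r"
        using thread_bounds[OF assms] that by blast+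
      then show ?thesis
        using dist_triangle2[of a b y] by linarith
    qed
    then have "diameter (thread y n) \<le> ?r + ?r"
      using thread_bounds[OF assms, of n] unfolding diameter_def by (auto intro!: cSUP_least)
    then show ?thesis
      using radius_plus_eps_less[of n] by linarith
  qed
  then show ?thesis
    using thread_bounds[OF assms] nearest_map_thread[OF assms]
    by (simp add: topspace_fas_limit topspace_small_subsets)
qed

text \<open>
  Level \<open>n + 1\<close> of the thread of \<open>z\<close> lies within \<open>2 * \<epsilon> (Suc n)\<close> of \<open>y\<close>, which is at most half the
  distance from \<open>y\<close> to any other point of \<open>A n\<close>.
\<close>

lemma thread_eq_singleton:
  assumes "y \<in> A n" "z \<in> Y" "dist z y < \<epsilon> (Suc n)"
  shows "thread z n = {y}"
proof -
  have "nearest_points (A n) w = {y}" if w: "w \<in> thread z (Suc n)" for w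
  proof -
    have "dist w y < 2 * \<epsilon> (Suc n)"
      using dist_thread_less[OF assms(2) w] assms(3) dist_triangle[of w y z] by linarith
    then have far: "dist w y < dist w b" if "b \<in> A n" "b \<noteq> y" for b
      using separated[OF assms(1) that(1)] that(2) dist_triangle3[of y b w] by fastforce
    have "finite (A n)" "A n \<noteq> {}"
      using approximation[of n] assms(1) by (auto simp: finite_approximation_def)
    then have "nearest_points (A n) w \<noteq> {}"
      by (rule nearest_points_nonempty)
    moreover have "b = y" if b: "b \<in> nearest_points (A n) w" for b
    proof (rule ccontr)
      assume "b \<noteq> y"
      moreover have "b \<in> A n" "dist w b \<le> dist w y"
        using b infdist_le[OF assms(1), of w] by (auto simp: nearest_points_def)
      ultimately show False using far by force
    qed
    ultimately show ?thesis by blast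
  qed
  moreover have "thread z (Suc n) \<noteq> {}"
    using thread_bounds[OF assms(2)] by blast
  ultimately have "nearest_map (A n) (thread z (Suc n)) = {y}"
    by (simp add: nearest_map_def)
  then show ?thesis
    by (simp add: nearest_map_thread[OF assms(2)])
qed

lemma thread_close:
  assumes "z \<in> Y" "thread z n \<subseteq> {y}"
  shows "dist z y < \<epsilon> n"
proof -
  have "y \<in> thread z n"
    using assms thread_bounds[OF assms(1), of n] by blast
  then show ?thesis
    using dist_thread_less[OF assms(1)] by (simp add: dist_commute)
qed

lemma ex_level:
  assumes "y \<in> Y" "0 < e"
  obtains n where "y \<in> A n" "\<epsilon> n < e"
proof -
  obtain N where N: "y \<in> A N" using assms(1) exhausts by blast
  have "\<forall>\<^sub>F n in sequentially. \<epsilon> n < e \<and> N \<le> n"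
    using order_tendstoD(2)[OF eps_tendsto assms(2)] eventually_ge_at_top[of N]
    by (rule eventually_conj)
  then obtain n where "\<epsilon> n < e" "N \<le> n"
    by (auto dest: eventually_happens)
  then show thesis
    using that N A_mono by blast
qed

lemma thread_inj: "inj_on thread Y"
proof (rule inj_onI, rule ccontr)
  fix y z assume yz: "y \<in> Y" "z \<in> Y" "thread y = thread z" "y \<noteq> z"
  obtain n where n: "y \<in> A n" "\<epsilon> n < dist z y"
    using ex_level[OF yz(1), of "dist z y"] yz(4) by auto
  have "thread z n \<subseteq> {y}"
    using thread_eq_singleton_self[OF n(1)] yz(3) by simp
  then show False
    using thread_close[OF yz(2)] n(2) by fastforce
qed

lemma continuous_map_thread: "continuous_map (top_of_set Y) (fas_limit \<epsilon> A) thread"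
  unfolding continuous_map
proof (intro conjI allI impI)
  show "thread ` topspace (top_of_set Y) \<subseteq> topspace (fas_limit \<epsilon> A)"
    using thread_in_fas_limit by auto
  fix W assume W: "openin (fas_limit \<epsilon> A) W"
  have "\<exists>d>0. ball y d \<inter> Y \<subseteq> {y \<in> Y. thread y \<in> W}" if y: "y \<in> Y" "thread y \<in> W" for y
  proof -
    obtain N where N: "y \<in> A N" using y(1) exhausts by blast
    obtain n where n: "N \<le> n"
      and nW: "\<And>D. D \<in> topspace (fas_limit \<epsilon> A) \<Longrightarrow> D n \<subseteq> thread y n \<Longrightarrow> D \<in> W"
      using openin_fas_limit_contains_below[OF W y(2)] by blast
    have yn: "y \<in> A n" using N A_mono[OF n] by blast
    have "ball y (\<epsilon> (Suc n)) \<inter> Y \<subseteq> {y \<in> Y. thread y \<in> W}"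
    proof clarify
      fix z assume "z \<in> ball y (\<epsilon> (Suc n))" and z: "z \<in> Y"
      then have "thread z n = {y}"
        by (intro thread_eq_singleton yn) (auto simp: dist_commute)
      then show "thread z \<in> W"
        using nW thread_in_fas_limit[OF z] thread_eq_singleton_self[OF yn] by simp
    qed
    then show ?thesis
      using eps_pos by blast
  qed
  then have "openin (top_of_set Y) {y \<in> Y. thread y \<in> W}"
    unfolding openin_contains_ball by blast
  then show "openin (top_of_set Y) {y \<in> topspace (top_of_set Y). thread y \<in> W}"
    by simp
qed

lemma open_map_thread: "open_map (top_of_set Y) (subtopology (fas_limit \<epsilon> A) (thread ` Y)) thread"
  unfolding open_map_def
proof (intro allI impI)
  fix U assume U: "openin (top_of_set Y) U"
  then have UY: "U \<subseteq> Y" by (simp add: openin_contains_ball)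
  have "\<exists>V. openin (subtopology (fas_limit \<epsilon> A) (thread ` Y)) V \<and> thread y \<in> V \<and> V \<subseteq> thread ` U"
    if y: "y \<in> U" for y
  proof -
    obtain e where e: "0 < e" "ball y e \<inter> Y \<subseteq> U"
      using U y unfolding openin_contains_ball by blast
    have yY: "y \<in> Y" using y UY by blast
    obtain n where n: "y \<in> A n" "\<epsilon> n < e"
      using ex_level[OF yY e(1)] .
    let ?V = "{D \<in> topspace (fas_limit \<epsilon> A). D n \<subseteq> thread y n} \<inter> thread ` Y"
    have "openin (subtopology (fas_limit \<epsilon> A) (thread ` Y)) ?V"
      by (intro openin_subtopology_Int openin_fas_limit_below thread_in_fas_limit yY)
    moreover have "thread y \<in> ?V"
      using yY thread_in_fas_limit by blast
    moreover have "?V \<subseteq> thread ` U"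
    proof clarify
      fix z assume z: "z \<in> Y" "thread z n \<subseteq> thread y n"
      then have "dist z y < e"
        using thread_close[of z n y] thread_eq_singleton_self[OF n(1)] n(2) by simp
      then show "thread z \<in> thread ` U"
        using e(2) z(1) by (auto simp: dist_commute)
    qed
    ultimately show ?thesis by blast
  qed
  then show "openin (subtopology (fas_limit \<epsilon> A) (thread ` Y)) (thread ` U)"
    by (subst openin_subopen) blast
qed

lemma threads_homeomorphic:
  "subtopology (fas_limit \<epsilon> A) (thread ` Y) homeomorphic_space top_of_set Y"
proof -
  have "topspace (subtopology (fas_limit \<epsilon> A) (thread ` Y)) = thread ` Y"
    using thread_in_fas_limit by auto
  then have "homeomorphic_map (top_of_set Y) (subtopology (fas_limit \<epsilon> A) (thread ` Y)) thread"
    using continuous_map_thread open_map_thread thread_inj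
    by (intro bijective_open_imp_homeomorphic_map) (auto simp: continuous_map_in_subtopology)
  then show ?thesis
    using homeomorphic_map_imp_homeomorphic_space homeomorphic_space_sym by blast
qed

lemma threads_dense:
  "fas_limit \<epsilon> A closure_of (thread ` Y) = topspace (fas_limit \<epsilon> A)"
proof (rule subset_antisym[OF closure_of_subset_topspace], rule subsetI)
  fix C assume C: "C \<in> topspace (fas_limit \<epsilon> A)"
  have "\<exists>D\<in>thread ` Y. D \<in> W" if W: "C \<in> W" "openin (fas_limit \<epsilon> A) W" for W
  proof -
    obtain n where nW: "\<And>D. D \<in> topspace (fas_limit \<epsilon> A) \<Longrightarrow> D n \<subseteq> C n \<Longrightarrow> D \<in> W"
      using openin_fas_limit_contains_below[OF W(2,1)] by blast
    obtain c where c: "c \<in> C n" "c \<in> A n"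
      using C by (fastforce simp: topspace_fas_limit topspace_small_subsets)
    then have "c \<in> Y" using A_subset_Y by blast
    moreover have "thread c n \<subseteq> C n"
      using c thread_eq_singleton_self by simp
    ultimately show ?thesis
      using nW thread_in_fas_limit by blast
  qed
  then show "C \<in> fas_limit \<epsilon> A closure_of (thread ` Y)"
    using C by (auto simp: in_closure_of)
qed

end

section \<open>Choosing the approximations inside the dense set\<close>

lemma ex_finite_approximation_within_dense:
  assumes "compact X" "Y \<subseteq> X" "X \<subseteq> closure Y" "finite B" "B \<subseteq> Y" "0 < e"
  obtains A where "finite_approximation X e A" "B \<subseteq> A" "A \<subseteq> Y"
proof -
  have "X \<subseteq> (\<Union>y\<in>Y. ball y e)"
    using assms(3,6) by (fastforce simp: closure_approachable)
  then obtain F where F: "F \<subseteq> Y" "finite F" "X \<subseteq> (\<Union>y\<in>F. ball y e)"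
    using compactE_image[OF assms(1), of Y "\<lambda>y. ball y e"] by auto
  then have "finite_approximation X e (F \<union> B)"
    using assms(2,4,5) by (fastforce simp: finite_approximation_def dist_commute)
  then show thesis
    using that F(1) assms(5) by blast
qed

lemma finite_separation:
  fixes A :: "'a::metric_space set"
  assumes "finite A"
  obtains s where "0 < s" "\<And>a b. a \<in> A \<Longrightarrow> b \<in> A \<Longrightarrow> a \<noteq> b \<Longrightarrow> s \<le> dist a b"
proof -
  let ?D = "insert 1 ((\<lambda>(a, b). dist a b) ` {(a, b) \<in> A \<times> A. a \<noteq> b})"
  have fin: "finite ?D"
    using finite_subset[of "{(a, b) \<in> A \<times> A. a \<noteq> b}" "A \<times> A"] assms by auto
  show thesis
  proof
    show "0 < Min ?D" using fin by (subst Min_gr_iff) auto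
    show "Min ?D \<le> dist a b" if "a \<in> A" "b \<in> A" "a \<noteq> b" for a b
      using that by (intro Min_le[OF fin]) auto
  qed
qed

text \<open>
  All conditions on \<open>\<epsilon> (Suc n)\<close> are upper bounds determined by \<open>\<epsilon> n\<close> and \<open>A n\<close>, so level
  \<open>n + 1\<close> can be chosen once level \<open>n\<close> is known. Putting the first points of an enumeration of
  \<open>Y\<close> into \<open>A n\<close> makes the approximations exhaust \<open>Y\<close>.
\<close>

lemma ex_separated_fas:
  fixes X Y :: "'a::metric_space set"
  assumes X: "compact X" and Y: "countable Y" "Y \<subseteq> X" "X \<subseteq> closure Y"
  obtains \<epsilon> A where "separated_fas X Y \<epsilon> A"
proof -
  define I where "I n = {y \<in> Y. to_nat_on Y y \<le> n}" for n
  have finite_I: "finite (I n)" for n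
  proof (rule finite_imageD)
    show "finite (to_nat_on Y ` I n)"
      by (rule finite_subset[of _ "{..n}"]) (auto simp: I_def)
    show "inj_on (to_nat_on Y) (I n)"
      by (rule inj_on_subset[OF inj_on_to_nat_on[OF Y(1)]]) (auto simp: I_def)
  qed
  have I_Y: "I n \<subseteq> Y" for n by (auto simp: I_def)
  define P where "P n s \<longleftrightarrow> 0 < fst s \<and> finite_approximation X (fst s) (snd s) \<and>
    I n \<subseteq> snd s \<and> snd s \<subseteq> Y" for n and s :: "real \<times> 'a set"
  define Q where "Q s t \<longleftrightarrow> adjusted X (snd s) (fst s) (fst t) \<and> snd s \<subseteq> snd t \<and>
    (\<forall>a\<in>snd s. \<forall>b\<in>snd s. a \<noteq> b \<longrightarrow> 4 * fst t \<le> dist a b)" for s t :: "real \<times> 'a set"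
  have "\<exists>f. \<forall>n. P n (f n) \<and> Q (f n) (f (Suc n))"
  proof (rule dependent_nat_choice)
    obtain A where "finite_approximation X 1 A" "I 0 \<subseteq> A" "A \<subseteq> Y"
      using ex_finite_approximation_within_dense[OF X Y(2,3) finite_I I_Y, of 1] by auto
    then show "\<exists>s. P 0 s"
      by (intro exI[of _ "(1, A)"]) (simp add: P_def)
  next
    fix s n assume "P n s"
    then obtain e A where s: "s = (e, A)" and e: "0 < e" and A: "finite_approximation X e A" "A \<subseteq> Y"
      by (cases s) (auto simp: P_def)
    have finA: "finite A" using A(1) by (simp add: finite_approximation_def)
    obtain d where d: "0 < d" "\<And>a b. a \<in> A \<Longrightarrow> b \<in> A \<Longrightarrow> a \<noteq> b \<Longrightarrow> d \<le> dist a b"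
      using finite_separation[OF finA] by blast
    define e' where "e' = Min {e, (e - approximation_radius X A) / 2, d / 2} / 2"
    have "0 < e - approximation_radius X A"
      using approximation_radius_less[OF X e A(1)] by simp
    then have e': "0 < e'" "e' < e" "e' < (e - approximation_radius X A) / 2" "4 * e' \<le> d"
      using e d(1) by (auto simp: e'_def min_def)
    obtain A' where A': "finite_approximation X e' A'" "A \<union> I (Suc n) \<subseteq> A'" "A' \<subseteq> Y"
      using ex_finite_approximation_within_dense[OF X Y(2,3), of "A \<union> I (Suc n)" e']
        finA finite_I A(2) I_Y e'(1) by blast
    have "P (Suc n) (e', A')"
      using A' e'(1) by (simp add: P_def)
    moreover have "Q s (e', A')"
      using A'(2) e' d(2) by (auto simp: Q_def s adjusted_def intro: order_trans)
    ultimately show "\<exists>t. P (Suc n) t \<and> Q s t" by blast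
  qed
  then obtain f where f: "\<And>n. P n (f n)" "\<And>n. Q (f n) (f (Suc n))" by blast
  define \<epsilon> where "\<epsilon> n = fst (f n)" for n
  define A where "A n = snd (f n)" for n
  note * = f[unfolded P_def Q_def, folded \<epsilon>_def A_def]
  have "separated_fas X Y \<epsilon> A"
  proof
    \<comment> \<open>Convergence to zero costs nothing extra: adjustedness already halves \<open>\<epsilon>\<close>.\<close>
    have half: "\<epsilon> (Suc n) \<le> \<epsilon> n / 2" for n
    proof (cases "X = {}")
      case True
      then show ?thesis
        using *(2)[of n] by (simp add: adjusted_def approximation_radius_def)
    next
      case False
      then obtain x where x: "x \<in> X" by blast
      have "0 \<le> approximation_radius X (A n)"
        using infdist_le_approximation_radius[OF _ x, of "\<epsilon> n" "A n"] *(1)[of n]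
          infdist_nonneg[of x "A n"] by linarith
      then show ?thesis
        using *(2)[of n] by (simp add: adjusted_def)
    qed
    have bound: "\<epsilon> n \<le> \<epsilon> 0 * (1/2) ^ n" for n
    proof (induction n)
      case (Suc n)
      then show ?case using half[of n] by simp
    qed simp
    have "(\<lambda>n. \<epsilon> 0 * (1/2) ^ n) \<longlonglongrightarrow> \<epsilon> 0 * 0"
      by (intro tendsto_intros) simp
    then have "\<epsilon> \<longlonglongrightarrow> 0"
      using *(1) bound
      by (intro tendsto_sandwich[of "\<lambda>_. 0" \<epsilon> sequentially "\<lambda>n. \<epsilon> 0 * (1/2) ^ n"])
        (auto intro: always_eventually less_imp_le)
    then show "finite_approximative_sequence X \<epsilon> A"
      using * by (simp add: finite_approximative_sequence_def)
    have "y \<in> A (to_nat_on Y y)" if "y \<in> Y" for y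
      using *(1)[of "to_nat_on Y y"] that by (auto simp: I_def)
    then show "(\<Union>n. A n) = Y"
      using *(1) by blast
  qed (use * Y(2) in auto)
  then show thesis by (rule that)
qed

theorem proposition9:
  fixes X Y :: "'a::metric_space set"
  assumes "compact X"
    and "countable Y" and "Y \<subseteq> X" and "X \<subseteq> closure Y"
  shows "\<exists>\<epsilon> A. finite_approximative_sequence X \<epsilon> A \<and>
    (\<exists>D \<subseteq> topspace (fas_limit \<epsilon> A).
      fas_limit \<epsilon> A closure_of D = topspace (fas_limit \<epsilon> A) \<and>
      subtopology (fas_limit \<epsilon> A) D homeomorphic_space top_of_set Y)"
proof -
  obtain \<epsilon> A where "separated_fas X Y \<epsilon> A"
    using ex_separated_fas[OF assms] .
  then interpret separated_fas X Y \<epsilon> A .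
  have "thread ` Y \<subseteq> topspace (fas_limit \<epsilon> A)"
    using thread_in_fas_limit by blast
  then show ?thesis
    using fas threads_dense threads_homeomorphic by blast
qed

end
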